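(* Let $I=\mathfrak{q}_1 \cap \cdots \cap \mathfrak{q}_r$ be an irredundant irreducible decomposition of a monomial ideal $I\subset S=\mathbb{K}[x_1,\ldots,x_n]$. Then for all $k \geq 1$: (a) $I^k \subseteq I^{\{k\}}$. (b) $\mathrm{sat}(I^{\{k\}}) \leq \max\{\mathrm{sat}(\mathfrak{q}_i^k) : i=1, \ldots , r\}$. (c) If $I$ is $\mathfrak{m}$-primary, then $\mathrm{sat}(I^{\{k\}})= \max\{\mathrm{sat}(\mathfrak{q}_i^k) : i=1, \ldots , r\}$.
   Context: $\mathbb{K}$ is a field, $S=\mathbb{K}[x_1,\ldots,x_n]$ is the polynomial ring ($n\ge 1$) and $\mathfrak{m}=(x_1,\ldots,x_n)$. For ideals $I,J$ of $S$, $I\colon J=\{f\in S : fJ\subseteq I\}$, and $\mathfrak{m}^0=S$. The saturation number of an ideal $I\subset S$ is $\mathrm{sat}(I)=\min\{k\geq 0 : I\colon\mathfrak{m}^k=I\colon\mathfrak{m}^{k+1}\}$. An irreducible monomial ideal is one of the form $(x_{i_1}^{c_1},\ldots,x_{i_p}^{c_p})$ with distinct indices and all $c_j>0$. Every proper monomial ideal $I$ has a decomposition $I=\mathfrak{q}_1\cap\cdots\cap\mathfrak{q}_r$ into irreducible monomial ideals that is irredundant (no $\mathfrak{q}_i$ can be omitted), unique up to order; the $\{k\}$-th symbolic power of $I$ is then defined by $I^{\{k\}}:=\bigcap_{i=1}^{r}\mathfrak{q}_i^k$. *)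

theory Defs
  imports
    "HOL-Library.Poly_Mapping"
    "HOL-Algebra.Ideal_Product"
    "HOL-Algebra.Algebraic_Closure_Type"
begin

section \<open>Ideals of a commutative ring\<close>

text \<open>In \<^const>\<open>ideals_set\<close> multiplication is the product of ideals and the unit is the whole ring,
  so the zeroth power of an ideal is the whole ring.\<close>

abbreviation ideal_power :: "('a, 'b) ring_scheme \<Rightarrow> 'a set \<Rightarrow> nat \<Rightarrow> 'a set" where
  "ideal_power R I k \<equiv> I [^]\<^bsub>ideals_set R\<^esub> k"

definition colon_ideal :: "('a, 'b) ring_scheme \<Rightarrow> 'a set \<Rightarrow> 'a set \<Rightarrow> 'a set" where
  "colon_ideal R I J = {f \<in> carrier R. \<forall>g\<in>J. f \<otimes>\<^bsub>R\<^esub> g \<in> I}"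

definition radical_ideal :: "('a, 'b) ring_scheme \<Rightarrow> 'a set \<Rightarrow> 'a set" where
  "radical_ideal R I = {f \<in> carrier R. \<exists>e::nat. f [^]\<^bsub>R\<^esub> e \<in> I}"

definition primary_ideal :: "('a, 'b) ring_scheme \<Rightarrow> 'a set \<Rightarrow> bool" where
  "primary_ideal R I \<longleftrightarrow> ideal I R \<and> I \<noteq> carrier R \<and>
     (\<forall>f\<in>carrier R. \<forall>g\<in>carrier R. f \<otimes>\<^bsub>R\<^esub> g \<in> I \<longrightarrow> f \<in> I \<or> g \<in> radical_ideal R I)"


section \<open>The polynomial ring\<close>

text \<open>Polynomials over \<open>'k\<close> in the variables indexed by the finite type \<open>'n\<close>: finitely supported
  functions from exponent vectors to coefficients. The number of variables is \<open>CARD('n) \<ge> 1\<close>.\<close>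

type_synonym ('n, 'k) mvpoly = "('n \<Rightarrow>\<^sub>0 nat) \<Rightarrow>\<^sub>0 'k"

abbreviation polyring :: "('n::finite, 'k::field) mvpoly ring" where
  "polyring \<equiv> ring_of_type_algebra"

definition monomial :: "('n::finite \<Rightarrow>\<^sub>0 nat) \<Rightarrow> ('n, 'k::field) mvpoly" where
  "monomial a = Poly_Mapping.single a 1"

definition variable :: "'n::finite \<Rightarrow> ('n, 'k::field) mvpoly" where
  "variable i = monomial (Poly_Mapping.single i 1)"

definition vars_ideal :: "('n::finite, 'k::field) mvpoly set" where
  "vars_ideal = genideal polyring (range variable)"

definition vars_primary :: "('n::finite, 'k::field) mvpoly set \<Rightarrow> bool" where
  "vars_primary I \<longleftrightarrow> primary_ideal polyring I \<and> radical_ideal polyring I = vars_ideal"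

text \<open>The ring is Noetherian, so for every ideal the ascending chain of colon ideals stabilises and
  the minimum below is attained.\<close>

definition sat :: "('n::finite, 'k::field) mvpoly set \<Rightarrow> nat" where
  "sat I = (LEAST k. colon_ideal polyring I (ideal_power polyring vars_ideal k) =
                     colon_ideal polyring I (ideal_power polyring vars_ideal (k + 1)))"


section \<open>Monomial ideals and symbolic powers\<close>

definition monomial_ideal :: "('n::finite, 'k::field) mvpoly set \<Rightarrow> bool" where
  "monomial_ideal I \<longleftrightarrow> (\<exists>M. I = genideal polyring (monomial ` M))"

text \<open>The index set \<open>A\<close> may be empty: the zero ideal counts as irreducible. Otherwise the zero ideal
  would be a proper monomial ideal without an irreducible decomposition.\<close>

definition irreducible_monomial_ideal :: "('n::finite, 'k::field) mvpoly set \<Rightarrow> bool" where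
  "irreducible_monomial_ideal I \<longleftrightarrow>
     (\<exists>A c. (\<forall>i\<in>A. c i > 0) \<and> I = genideal polyring ((\<lambda>i. variable i ^ c i) ` A))"

text \<open>For \<open>r = 1\<close> the intersection over the remaining indices is the intersection of the empty
  family, that is \<^const>\<open>UNIV\<close>, the carrier of the polynomial ring.\<close>

definition irredundant_decomposition ::
    "('n::finite, 'k::field) mvpoly set \<Rightarrow> nat \<Rightarrow> (nat \<Rightarrow> ('n, 'k) mvpoly set) \<Rightarrow> bool" where
  "irredundant_decomposition I r q \<longleftrightarrow>
     r \<ge> 1 \<and>
     (\<forall>i\<in>{1..r}. irreducible_monomial_ideal (q i)) \<and>
     I = (\<Inter>i\<in>{1..r}. q i) \<and>
     (\<forall>j\<in>{1..r}. (\<Inter>i\<in>{1..r} - {j}. q i) \<noteq> I)"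

text \<open>The decomposition of a proper monomial ideal exists and is unique up to the order of the
  components; these are pairwise distinct by irredundancy, so they form a well-defined set.\<close>

definition irreducible_components ::
    "('n::finite, 'k::field) mvpoly set \<Rightarrow> ('n, 'k) mvpoly set set" where
  "irreducible_components I =
     (THE Q. \<exists>r q. irredundant_decomposition I r q \<and> Q = q ` {1..r})"

definition symbolic_power ::
    "('n::finite, 'k::field) mvpoly set \<Rightarrow> nat \<Rightarrow> ('n, 'k) mvpoly set" where
  "symbolic_power I k = (\<Inter>Q\<in>irreducible_components I. ideal_power polyring Q k)"

end

theory Submission
  imports Defs
begin

text \<open>
  If \<open>\<qq> = (x\<^sub>i ^ c\<^sub>i : i \<in> A)\<close>, a polynomial lies in \<open>\<qq>\<^sup>k\<close> iff
  \<open>\<Sum>i\<in>A. \<lfloor>a\<^sub>i / c\<^sub>i\<rfloor> \<ge> k\<close> for each of its exponents \<open>a\<close>. Hence the colon ideals of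
  \<open>\<qq>\<^sup>k\<close> are constant if \<open>A\<close> misses a variable
  (a nonzerodivisor modulo \<open>\<qq>\<^sup>k\<close>), and eventually the whole ring otherwise. Once two
  consecutive colon ideals agree the chain is constant, and colon ideals commute with
  intersections, which gives (b). For (c), every component involves all the variables, and then
  the saturation number of an ideal is the least \<open>s\<close> such that the ideal contains
  \<open>\<mm>\<^sup>s\<close>; such \<open>s\<close> for an intersection are those that work for all its members.
  The components are determined by \<open>I\<close> because an irreducible ideal that contains an intersection of
  monomial ideals contains one of them: monomials outside
  it, one from each, have a common multiple outside it.
\<close>

section \<open>Ideals of the polynomial ring\<close>

lemma polyring_simps [simp]:
  "carrier (polyring :: ('n::finite, 'k::field) mvpoly ring) = UNIV"
  "f \<otimes>\<^bsub>(polyring :: ('n, 'k) mvpoly ring)\<^esub> g = f * g"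
  "f \<oplus>\<^bsub>(polyring :: ('n, 'k) mvpoly ring)\<^esub> g = f + g"
  "\<zero>\<^bsub>(polyring :: ('n, 'k) mvpoly ring)\<^esub> = 0"
  "\<one>\<^bsub>(polyring :: ('n, 'k) mvpoly ring)\<^esub> = 1"
  by (simp_all add: ring_of_type_algebra_def)

lemma ring_polyring: "ring (polyring :: ('n::finite, 'k::field) mvpoly ring)"
  by (rule ring_from_type_algebra)

text \<open>Additive inverses need no condition of their own: they are multiples by
  \<open>- 1\<close>.\<close>

lemma ideal_polyringI:
  fixes J :: "('n::finite, 'k::field) mvpoly set"
  assumes "0 \<in> J" and "\<And>f g. f \<in> J \<Longrightarrow> g \<in> J \<Longrightarrow> f + g \<in> J" and "\<And>f g. f \<in> J \<Longrightarrow> g * f \<in> J"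
  shows "ideal J polyring"
proof (rule idealI[OF ring_polyring])
  interpret P: ring "polyring :: ('n, 'k) mvpoly ring" by (rule ring_polyring)
  show "subgroup J (add_monoid polyring)"
  proof (rule P.add.subgroupI)
    fix f assume "f \<in> J"
    moreover have "\<ominus>\<^bsub>polyring\<^esub> f = - f"
      by (rule P.minus_equality) simp_all
    ultimately show "\<ominus>\<^bsub>polyring\<^esub> f \<in> J"
      using assms(3)[of f "- 1"] by simp
  qed (use assms in auto)
next
  show "x \<otimes>\<^bsub>polyring\<^esub> a \<in> J" "a \<otimes>\<^bsub>polyring\<^esub> x \<in> J" if "a \<in> J" for a x
    using assms(3)[OF that, of x] by (simp_all add: mult.commute)
qed

lemma
  fixes J :: "('n::finite, 'k::field) mvpoly set"
  assumes "ideal J polyring"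
  shows polyring_ideal_zero: "0 \<in> J"
    and polyring_ideal_add: "f \<in> J \<Longrightarrow> g \<in> J \<Longrightarrow> f + g \<in> J"
    and polyring_ideal_mult: "f \<in> J \<Longrightarrow> g * f \<in> J"
    and polyring_ideal_sum: "(\<And>x. x \<in> B \<Longrightarrow> h x \<in> J) \<Longrightarrow> sum h B \<in> J"
proof -
  show zero: "0 \<in> J"
    using additive_subgroup.zero_closed[OF ideal.axioms(1)[OF assms]] by simp
  show add: "f \<in> J \<Longrightarrow> g \<in> J \<Longrightarrow> f + g \<in> J" for f g
    using additive_subgroup.a_closed[OF ideal.axioms(1)[OF assms], of f g] by simp
  show "f \<in> J \<Longrightarrow> g * f \<in> J"
    using ideal.I_l_closed[OF assms, of f g] by simp
  show "(\<And>x. x \<in> B \<Longrightarrow> h x \<in> J) \<Longrightarrow> sum h B \<in> J"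
    by (induction B rule: infinite_finite_induct) (auto intro: zero add)
qed

section \<open>Powers of ideals\<close>

lemma ideal_power_0: "ideal_power polyring (J :: ('n::finite, 'k::field) mvpoly set) 0 = UNIV"
  by (simp add: ideals_set_def)

lemma ideal_power_Suc:
  "ideal_power polyring (J :: ('n::finite, 'k::field) mvpoly set) (Suc k)
    = ideal_prod polyring (ideal_power polyring J k) J"
  by (simp add: ideals_set_def)

lemma ideal_ideal_power:
  assumes "ideal (J :: ('n::finite, 'k::field) mvpoly set) polyring"
  shows "ideal (ideal_power polyring J k) polyring"
proof (induction k)
  case 0
  then show ?case unfolding ideal_power_0 by (rule ideal_polyringI) auto
next
  case (Suc k)
  then show ?case
    unfolding ideal_power_Suc by (rule ring.ideal_prod_is_ideal[OF ring_polyring _ assms])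
qed

lemma ideal_power_mono:
  fixes I J :: "('n::finite, 'k::field) mvpoly set"
  assumes "I \<subseteq> J"
  shows "ideal_power polyring I k \<subseteq> ideal_power polyring J k"
proof (induction k)
  case 0
  then show ?case by (simp add: ideal_power_0)
next
  case (Suc k)
  show ?case
  proof
    fix f assume "f \<in> ideal_power polyring I (Suc k)"
    then show "f \<in> ideal_power polyring J (Suc k)"
      unfolding ideal_power_Suc
      by (induction rule: ideal_prod.induct)
        (use Suc assms in \<open>blast intro: ideal_prod.intros\<close>)+
  qed
qed

section \<open>Monomials\<close>

abbreviation "lookup \<equiv> Poly_Mapping.lookup"
abbreviation "keys \<equiv> Poly_Mapping.keys"

lemma monomial_add: "monomial (a + b) = (monomial a * monomial b :: ('n::finite, 'k::field) mvpoly)"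
  by (simp add: monomial_def mult_single)

lemma keys_monomial [simp]: "keys (monomial a :: ('n::finite, 'k::field) mvpoly) = {a}"
  by (simp add: monomial_def)

lemma variable_power:
  "variable i ^ m = (monomial (Poly_Mapping.single i m) :: ('n::finite, 'k::field) mvpoly)"
proof (induction m)
  case 0
  then show ?case by (simp add: monomial_def)
next
  case (Suc m)
  then show ?case by (simp add: variable_def flip: monomial_add single_add)
qed

text \<open>Multiplying by one monomial translates exponents injectively, so no terms cancel. This
  exact description of the support later lets a variable outside \<open>A\<close> be cancelled
  modulo a power of \<open>irred A c\<close>.\<close>

lemma keys_mult_monomial:
  "keys (f * monomial b :: ('n::finite, 'k::field) mvpoly) = (\<lambda>a. a + b) ` keys f"
proof -
  have shift: "lookup (f * monomial b) (a + b) = lookup f a" for a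
  proof -
    \<comment> \<open>Only the summand \<open>q = b\<close> survives, and then
      \<open>a + b = l + q\<close> forces \<open>l = a\<close>.\<close>
    have "(\<Sum>q. (lookup (monomial b :: ('n, 'k) mvpoly) q when a + b = l + q)) = (1 when l = a)"
      for l
    proof -
      have "(lookup (monomial b :: ('n, 'k) mvpoly) q when a + b = l + q)
          = ((1 when l = a) when q = b)" for q
        by (auto simp: monomial_def lookup_single when_def)
      then show ?thesis by simp
    qed
    then show ?thesis by (simp add: lookup_mult mult_when)
  qed
  show ?thesis
    using keys_mult[of f "monomial b"] shift by (auto simp: in_keys_iff)
qed

text \<open>Exponents of a product are sums of exponents, and an up-set absorbs them. Such ideals
  bound a monomial ideal from above; \<open>in_ideal_by_monomials\<close> supplies the reverse
  inclusion.\<close>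

lemma ideal_keys_upset:
  assumes "\<And>a b. a \<in> U \<Longrightarrow> b + a \<in> U"
  shows "ideal {f :: ('n::finite, 'k::field) mvpoly. keys f \<subseteq> U} polyring"
proof (rule ideal_polyringI)
  fix f g :: "('n, 'k) mvpoly"
  assume "f \<in> {f. keys f \<subseteq> U}"
  then show "g * f \<in> {f. keys f \<subseteq> U}"
    using keys_mult[of g f] assms by fastforce
qed (use keys_add in fastforce)+

lemma in_ideal_by_monomials:
  fixes f :: "('n::finite, 'k::field) mvpoly"
  assumes "ideal J polyring" and "\<And>a. a \<in> keys f \<Longrightarrow> monomial a \<in> J"
  shows "f \<in> J"
proof -
  have "f = (\<Sum>a\<in>keys f. Poly_Mapping.single 0 (lookup f a) * monomial a)"
  proof (rule poly_mapping_eqI)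
    fix b
    show "lookup f b = lookup (\<Sum>a\<in>keys f. Poly_Mapping.single 0 (lookup f a) * monomial a) b"
      by (auto simp: lookup_sum monomial_def mult_single lookup_single when_def in_keys_iff)
  qed
  also have "\<dots> \<in> J"
    by (intro polyring_ideal_sum polyring_ideal_mult assms)
  finally show ?thesis .
qed

text \<open>Subtraction of exponents is truncated; the pointwise bound says that one monomial
  divides the other, so here nothing is cut off.\<close>

lemma exponent_split:
  fixes a b :: "'n \<Rightarrow>\<^sub>0 nat"
  assumes "\<And>i. lookup b i \<le> lookup a i"
  shows "a = (a - b) + b"
  by (rule poly_mapping_eqI) (simp add: lookup_add lookup_minus assms)

section \<open>Irreducible monomial ideals and their powers\<close>

abbreviation irred :: "'n::finite set \<Rightarrow> ('n \<Rightarrow> nat) \<Rightarrow> ('n, 'k::field) mvpoly set" where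
  "irred A c \<equiv> genideal polyring ((\<lambda>i. variable i ^ c i) ` A)"

lemma ideal_irred: "ideal (irred A c) polyring"
  by (rule ring.genideal_ideal[OF ring_polyring]) simp

lemma irred_generator: "i \<in> A \<Longrightarrow> monomial (Poly_Mapping.single i (c i)) \<in> irred A c"
  using ring.genideal_self[OF ring_polyring, of "(\<lambda>i. variable i ^ c i) ` A"]
  by (auto simp: variable_power)

lemma mem_irred_iff:
  fixes f :: "('n::finite, 'k::field) mvpoly"
  shows "f \<in> irred A c \<longleftrightarrow> (\<forall>a\<in>keys f. \<exists>i\<in>A. c i \<le> lookup a i)"
proof
  define U where "U = {a. \<exists>i\<in>A. c i \<le> lookup a i}"
  have "(irred A c :: ('n, 'k) mvpoly set) \<subseteq> {f. keys f \<subseteq> U}"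
  proof (rule ring.genideal_minimal[OF ring_polyring])
    show "ideal {f. keys f \<subseteq> U} polyring"
      by (rule ideal_keys_upset) (auto simp: U_def lookup_add intro: trans_le_add2)
    show "(\<lambda>i. variable i ^ c i) ` A \<subseteq> {f. keys f \<subseteq> U}"
      by (force simp: U_def variable_power)
  qed
  then show "\<forall>a\<in>keys f. \<exists>i\<in>A. c i \<le> lookup a i" if "f \<in> irred A c"
    using that by (auto simp: U_def)
next
  assume f: "\<forall>a\<in>keys f. \<exists>i\<in>A. c i \<le> lookup a i"
  show "f \<in> irred A c"
  proof (rule in_ideal_by_monomials[OF ideal_irred])
    fix a assume "a \<in> keys f"
    then obtain i where i: "i \<in> A" "c i \<le> lookup a i" using f by blast
    have a: "a = (a - Poly_Mapping.single i (c i)) + Poly_Mapping.single i (c i)"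
      by (rule exponent_split) (use i in \<open>auto simp: lookup_single when_def\<close>)
    have "monomial ((a - Poly_Mapping.single i (c i)) + Poly_Mapping.single i (c i)) \<in> irred A c"
      unfolding monomial_add by (intro polyring_ideal_mult ideal_irred irred_generator i(1))
    then show "monomial a \<in> irred A c" by (simp only: a[symmetric])
  qed
qed

text \<open>For positive \<open>c i\<close>, this is the largest number of generators, counted with
  repetition, whose product divides the monomial with exponent \<open>a\<close>.\<close>

definition weight :: "'n::finite set \<Rightarrow> ('n \<Rightarrow> nat) \<Rightarrow> ('n \<Rightarrow>\<^sub>0 nat) \<Rightarrow> nat" where
  "weight A c a = (\<Sum>i\<in>A. lookup a i div c i)"

lemma weight_superadditive: "weight A c a + weight A c b \<le> weight A c (a + b)"
proof -
  have "m div d + n div d \<le> (m + n) div d" for m n d :: nat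
    \<comment> \<open>The difference of the two sides is the carry from adding the
      remainders.\<close>
    by (subst div_add1_eq) simp
  then show ?thesis
    unfolding weight_def lookup_add sum.distrib[symmetric] by (intro sum_mono)
qed

lemma weight_pos_iff:
  assumes "\<And>i. i \<in> A \<Longrightarrow> c i > 0"
  shows "1 \<le> weight A c a \<longleftrightarrow> (\<exists>i\<in>A. c i \<le> lookup a i)"
proof -
  have "weight A c a = 0 \<longleftrightarrow> (\<forall>i\<in>A. lookup a i < c i)"
    using assms by (fastforce simp: weight_def div_eq_0_iff)
  then show ?thesis by (metis less_one linorder_not_less)
qed

text \<open>Both directions go by induction on \<open>k\<close>. A factor from the ideal raises the
  weight by at least one, by superadditivity; conversely, a monomial of positive weight is divisible
  by a generator, and dividing by it lowers the weight by exactly one.\<close>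

lemma mem_irred_power_iff:
  fixes f :: "('n::finite, 'k::field) mvpoly"
  assumes c: "\<And>i. i \<in> A \<Longrightarrow> c i > 0"
  shows "f \<in> ideal_power polyring (irred A c) k \<longleftrightarrow> (\<forall>a\<in>keys f. k \<le> weight A c a)"
proof
  show "\<forall>a\<in>keys f. k \<le> weight A c a" if "f \<in> ideal_power polyring (irred A c) k"
    using that
  proof (induction k arbitrary: f)
    case (Suc k)
    from Suc.prems show ?case
      unfolding ideal_power_Suc
    proof (induction rule: ideal_prod.induct)
      case (prod g h)
      show ?case
      proof
        fix a assume "a \<in> keys (g \<otimes>\<^bsub>polyring\<^esub> h)"
        then obtain b d where a: "a = b + d" and b: "b \<in> keys g" and d: "d \<in> keys h"
          using keys_mult[of g h] by auto
        have "k \<le> weight A c b" using Suc.IH[OF prod(1)] b by blast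
        moreover have "1 \<le> weight A c d"
          using prod(2) d weight_pos_iff[of A c, OF c] unfolding mem_irred_iff by blast
        ultimately show "Suc k \<le> weight A c a"
          using weight_superadditive[of A c b d] a by simp
      qed
    next
      case (sum g h)
      then show ?case using keys_add[of g h] by fastforce
    qed
  qed simp
next
  let ?q = "irred A c :: ('n, 'k) mvpoly set"
  have monomial: "monomial a \<in> ideal_power polyring ?q k" if "k \<le> weight A c a" for a
    using that
  proof (induction k arbitrary: a)
    case (Suc k)
    then obtain i where i: "i \<in> A" "c i \<le> lookup a i"
      using weight_pos_iff[of A c a, OF c] by auto
    define b where "b = a - Poly_Mapping.single i (c i)"
    have a: "a = b + Poly_Mapping.single i (c i)"
      unfolding b_def by (rule exponent_split) (use i in \<open>auto simp: lookup_single when_def\<close>)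
    \<comment> \<open>Only coordinate \<open>i\<close> changes, by exactly \<open>c i\<close>, so
      its quotient drops by one because \<open>c i\<close> is positive.\<close>
    have "lookup a j div c j = lookup b j div c j + (if j = i then 1 else 0)" if "j \<in> A" for j
      using c[OF that] by (auto simp: a lookup_add lookup_single when_def)
    then have "weight A c a = weight A c b + 1"
      using i(1) by (simp add: weight_def sum.distrib)
    then have "monomial b \<in> ideal_power polyring ?q k" using Suc by simp
    then show ?case
      using ideal_prod.prod[OF _ irred_generator[OF i(1)], of _ _ polyring]
      by (simp only: ideal_power_Suc a monomial_add polyring_simps)
  next
    case 0
    show ?case unfolding ideal_power_0 by simp
  qed
  show "f \<in> ideal_power polyring (irred A c) k" if "\<forall>a\<in>keys f. k \<le> weight A c a"
    using in_ideal_by_monomials[OF ideal_ideal_power[OF ideal_irred]] monomial that by blast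
qed

section \<open>Powers of the maximal ideal, where the weight is the total degree\<close>

lemma vars_ideal_eq: "vars_ideal = irred UNIV (\<lambda>_. 1)"
  by (simp add: vars_ideal_def)

lemma mem_vars_power_iff:
  "f \<in> ideal_power polyring vars_ideal s \<longleftrightarrow> (\<forall>a\<in>keys f. s \<le> (\<Sum>i\<in>UNIV. lookup a i))"
  unfolding vars_ideal_eq by (subst mem_irred_power_iff) (simp_all add: weight_def)

lemma vars_power_antimono:
  "s \<le> t \<Longrightarrow> ideal_power polyring vars_ideal t \<subseteq> ideal_power polyring vars_ideal s"
  using order_trans unfolding subset_iff mem_vars_power_iff by blast

lemma vars_power_subset_irred_power:
  assumes c: "\<And>i. c i > 0"
  shows "\<exists>s. ideal_power polyring vars_ideal s \<subseteq> ideal_power polyring (irred UNIV c) k"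
proof -
  \<comment> \<open>\<open>C\<close> serves twice: it bounds every \<open>c i\<close>, and it is the
    total of the bounds \<open>c i\<close> on the remainders. A weight below \<open>k\<close> thus
    forces a total degree of at most \<open>C * k\<close>.\<close>
  define C where "C = sum c UNIV"
  have cC: "c i \<le> C" for i unfolding C_def by (rule member_le_sum) auto
  have "k \<le> weight UNIV c a" if a: "C * k + 1 \<le> (\<Sum>i\<in>UNIV. lookup a i)" for a
  proof (rule ccontr)
    assume "\<not> k \<le> weight UNIV c a"
    then have "weight UNIV c a + 1 \<le> k" by simp
    then have Ck: "C * weight UNIV c a + C \<le> C * k"
      by (metis add_mult_distrib2 mult.right_neutral mult_le_mono2)
    have "lookup a i \<le> C * (lookup a i div c i) + c i" for i
    proof -
      have "lookup a i = c i * (lookup a i div c i) + lookup a i mod c i" by simp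
      also have "\<dots> \<le> C * (lookup a i div c i) + c i"
        using cC[of i] c[of i] by (intro add_mono mult_right_mono) (auto intro: less_imp_le)
      finally show ?thesis .
    qed
    then have "(\<Sum>i\<in>UNIV. lookup a i) \<le> (\<Sum>i\<in>UNIV. C * (lookup a i div c i) + c i)"
      by (rule sum_mono)
    also have "\<dots> = C * weight UNIV c a + C"
      by (simp add: sum.distrib weight_def C_def sum_distrib_left)
    finally show False using Ck a by linarith
  qed
  then have "ideal_power polyring vars_ideal (C * k + 1) \<subseteq> ideal_power polyring (irred UNIV c) k"
    unfolding subset_iff mem_vars_power_iff mem_irred_power_iff[of UNIV, OF c] by blast
  then show ?thesis ..
qed

section \<open>Uniqueness of the irredundant irreducible decomposition\<close>

text \<open>A monomial lies outside \<open>irred A c\<close> iff its exponent at each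
  \<open>i\<close> in \<open>A\<close> is below \<open>c i\<close>. This is a condition on each
  variable separately, so it survives passing to a suitable common multiple.\<close>

lemma Inter_subset_irred:
  fixes Q :: "'j \<Rightarrow> ('n::finite, 'k::field) mvpoly set"
  assumes "finite T" and irr: "\<And>t. t \<in> T \<Longrightarrow> irreducible_monomial_ideal (Q t)"
    and c: "\<And>i. i \<in> A \<Longrightarrow> c i > 0" and sub: "(\<Inter>t\<in>T. Q t) \<subseteq> irred A c"
  shows "\<exists>t\<in>T. Q t \<subseteq> irred A c"
proof (rule ccontr)
  assume contra: "\<not> ?thesis"
  \<comment> \<open>If \<open>Q t\<close> is not contained in \<open>irred A c\<close>, some term of
    a polynomial in \<open>Q t\<close> lies outside; its exponent still passes the test for
    \<open>Q t\<close>, as do all its multiples.\<close>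
  have "\<exists>a. (\<forall>i\<in>A. lookup a i < c i)
      \<and> (\<forall>b. (\<forall>i. lookup a i \<le> lookup b i) \<longrightarrow> monomial b \<in> Q t)"
    if t: "t \<in> T" for t
  proof -
    obtain B d where Q: "Q t = irred B d"
      using irr[OF t] unfolding irreducible_monomial_ideal_def by blast
    obtain f where f: "f \<in> Q t" "f \<notin> irred A c" using contra t by blast
    then obtain a where a: "a \<in> keys f" "\<forall>i\<in>A. lookup a i < c i"
      unfolding mem_irred_iff by (auto simp: not_le)
    obtain i where "i \<in> B" "d i \<le> lookup a i" using f(1) a(1) unfolding Q mem_irred_iff by blast
    then have "\<forall>b. (\<forall>i. lookup a i \<le> lookup b i) \<longrightarrow> monomial b \<in> Q t"
      unfolding Q mem_irred_iff by (auto intro: order_trans)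
    with a(2) show ?thesis by blast
  qed
  then obtain a where a: "\<And>t i. t \<in> T \<Longrightarrow> i \<in> A \<Longrightarrow> lookup (a t) i < c i"
    "\<And>t b. t \<in> T \<Longrightarrow> (\<And>i. lookup (a t) i \<le> lookup b i) \<Longrightarrow> monomial b \<in> Q t"
    by metis
  \<comment> \<open>On \<open>A\<close> the exponent is the largest one that stays outside
    \<open>irred A c\<close>; elsewhere it is unconstrained, and the sum dominates every
    \<open>a t\<close>.\<close>
  define b where "b = Abs_poly_mapping (\<lambda>i. if i \<in> A then c i - 1 else (\<Sum>t\<in>T. lookup (a t) i))"
  have b: "lookup b i = (if i \<in> A then c i - 1 else (\<Sum>t\<in>T. lookup (a t) i))" for i
    unfolding b_def by simp
  have "monomial b \<in> Q t" if "t \<in> T" for t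
  proof (rule a(2)[OF that])
    fix i
    show "lookup (a t) i \<le> lookup b i"
      using a(1)[OF that, of i] member_le_sum[OF that, of "\<lambda>t. lookup (a t) i"] assms(1)
      by (auto simp: b)
  qed
  then have "monomial b \<in> (\<Inter>t\<in>T. Q t)" by blast
  from subsetD[OF sub this] obtain i where "i \<in> A" "c i \<le> c i - 1" by (auto simp: mem_irred_iff b)
  then show False using c[of i] by simp
qed

text \<open>A component that contains a different one could be omitted without changing the
  intersection.\<close>

lemma irredundant_component_unique:
  assumes "irredundant_decomposition I r q" and "i \<in> {1..r}" and "j \<in> {1..r}" and "q j \<subseteq> q i"
  shows "j = i"
proof (rule ccontr)
  assume "j \<noteq> i"
  then have "(\<Inter>l\<in>{1..r} - {i}. q l) \<subseteq> (\<Inter>l\<in>{1..r}. q l)"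
    using assms(3,4) by blast
  then have "(\<Inter>l\<in>{1..r} - {i}. q l) = I"
    using assms(1) unfolding irredundant_decomposition_def by blast
  then show False
    using assms(1,2) unfolding irredundant_decomposition_def by blast
qed

lemma irredundant_decomposition_component:
  fixes q q' :: "nat \<Rightarrow> ('n::finite, 'k::field) mvpoly set"
  assumes "irredundant_decomposition I r q" and "irredundant_decomposition I r' q'"
    and "i \<in> {1..r}"
  shows "\<exists>j\<in>{1..r'}. q' j \<subseteq> q i"
proof -
  obtain A c where q: "q i = irred A c" and c: "\<forall>l\<in>A. c l > 0"
    using assms(1,3) unfolding irredundant_decomposition_def irreducible_monomial_ideal_def by blast
  have irr: "irreducible_monomial_ideal (q' j)" if "j \<in> {1..r'}" for j
    using assms(2) that unfolding irredundant_decomposition_def by blast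
  have "(\<Inter>j\<in>{1..r'}. q' j) = (\<Inter>j\<in>{1..r}. q j)"
    using assms(1,2) unfolding irredundant_decomposition_def by metis
  then have sub: "(\<Inter>j\<in>{1..r'}. q' j) \<subseteq> irred A c"
    unfolding q[symmetric] using assms(3) by (simp add: INT_lower)
  show ?thesis
    unfolding q by (rule Inter_subset_irred[OF finite_atLeastAtMost irr _ sub]) (use c in auto)
qed

text \<open>Each \<open>q i\<close> contains some \<open>q' j\<close>, which in turn contains some
  \<open>q l\<close>. Irredundancy gives \<open>l = i\<close>, so the chain of inclusions collapses
  and \<open>q' j = q i\<close>.\<close>

lemma irredundant_decomposition_subset:
  fixes q q' :: "nat \<Rightarrow> ('n::finite, 'k::field) mvpoly set"
  assumes "irredundant_decomposition I r q" and "irredundant_decomposition I r' q'"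
  shows "q ` {1..r} \<subseteq> q' ` {1..r'}"
proof clarify
  fix i assume i: "i \<in> {1..r}"
  obtain j where j: "j \<in> {1..r'}" "q' j \<subseteq> q i"
    using irredundant_decomposition_component[OF assms i] by blast
  obtain l where l: "l \<in> {1..r}" "q l \<subseteq> q' j"
    using irredundant_decomposition_component[OF assms(2,1) j(1)] by blast
  have "l = i" using irredundant_component_unique[OF assms(1) i l(1)] l(2) j(2) by blast
  then show "q i \<in> q' ` {1..r'}" using l j by blast
qed

lemma irreducible_components_eq:
  assumes "irredundant_decomposition I r q"
  shows "irreducible_components I = q ` {1..r}"
  unfolding irreducible_components_def
proof (rule the_equality)
  show "\<exists>r' q'. irredundant_decomposition I r' q' \<and> q ` {1..r} = q' ` {1..r'}"
    using assms by blast
next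
  fix Q assume "\<exists>r q. irredundant_decomposition I r q \<and> Q = q ` {1..r}"
  then show "Q = q ` {1..r}"
    using irredundant_decomposition_subset assms by blast
qed

section \<open>Saturation numbers\<close>

abbreviation colon_vars :: "('n::finite, 'k::field) mvpoly set \<Rightarrow> nat \<Rightarrow> ('n, 'k) mvpoly set" where
  "colon_vars J s \<equiv> colon_ideal polyring J (ideal_power polyring vars_ideal s)"

lemma mem_colon_vars_iff:
  "f \<in> colon_vars J s \<longleftrightarrow> (\<forall>g\<in>ideal_power polyring vars_ideal s. f * g \<in> J)"
  by (simp add: colon_ideal_def)

text \<open>This is the identity \<open>J : m^(s+1) = (J : m^s) : m\<close>. Each colon ideal is
  therefore determined by its predecessor, which makes a single repetition in the chain
  permanent.\<close>

lemma colon_vars_Suc_iff: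
  fixes J :: "('n::finite, 'k::field) mvpoly set"
  assumes J: "ideal J polyring"
  shows "f \<in> colon_vars J (Suc s) \<longleftrightarrow> (\<forall>x\<in>vars_ideal. f * x \<in> colon_vars J s)"
proof
  assume f: "f \<in> colon_vars J (Suc s)"
  have "f * x * g \<in> J" if "x \<in> vars_ideal" "g \<in> ideal_power polyring vars_ideal s" for x g
  proof -
    have "g * x \<in> ideal_power polyring vars_ideal (Suc s)"
      using ideal_prod.prod[OF that(2,1), of polyring] by (simp only: ideal_power_Suc polyring_simps)
    then have "f * (g * x) \<in> J" using f unfolding mem_colon_vars_iff by blast
    then show ?thesis by (simp add: ac_simps)
  qed
  then show "\<forall>x\<in>vars_ideal. f * x \<in> colon_vars J s"
    unfolding mem_colon_vars_iff by blast
next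
  assume f: "\<forall>x\<in>vars_ideal. f * x \<in> colon_vars J s"
  have "f * g \<in> J" if "g \<in> ideal_prod polyring (ideal_power polyring vars_ideal s) vars_ideal" for g
    using that
  proof (induction rule: ideal_prod.induct)
    case (prod g h)
    then have "f * h * g \<in> J" using f by (simp add: mem_colon_vars_iff)
    then show ?case by (simp add: ac_simps)
  next
    case (sum g h)
    then show ?case by (simp add: distrib_left polyring_ideal_add[OF J])
  qed
  then show "f \<in> colon_vars J (Suc s)"
    unfolding mem_colon_vars_iff unfolding ideal_power_Suc by blast
qed

lemma colon_vars_stable:
  fixes J :: "('n::finite, 'k::field) mvpoly set"
  assumes J: "ideal J polyring" and "colon_vars J s = colon_vars J (s + 1)" and "s \<le> t"
  shows "colon_vars J t = colon_vars J s"
  using assms(3)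
proof (induction t rule: dec_induct)
  case (step t)
  have "colon_vars J (Suc t) = colon_vars J (Suc s)"
    by (rule Set.set_eqI) (simp only: colon_vars_Suc_iff[OF J] step.IH)
  then show ?case using assms(2) by simp
qed simp

text \<open>The witness \<open>s\<^sub>0\<close> ensures that the \<open>LEAST\<close> in
  \<open>sat\<close> is attained; stability then carries the repetition from \<open>sat J\<close> to
  every later index.\<close>

lemma sat_le_iff:
  fixes J :: "('n::finite, 'k::field) mvpoly set"
  assumes J: "ideal J polyring" and ex: "colon_vars J s\<^sub>0 = colon_vars J (s\<^sub>0 + 1)"
  shows "sat J \<le> s \<longleftrightarrow> colon_vars J s = colon_vars J (s + 1)"
proof
  assume le: "sat J \<le> s"
  have "colon_vars J (sat J) = colon_vars J (sat J + 1)"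
    unfolding sat_def by (rule LeastI[of _ s\<^sub>0]) (rule ex)
  note stable = colon_vars_stable[OF J this]
  show "colon_vars J s = colon_vars J (s + 1)"
    by (rule trans[OF stable[OF le] stable[OF trans_le_add1[OF le], symmetric]])
next
  assume "colon_vars J s = colon_vars J (s + 1)"
  then show "sat J \<le> s" unfolding sat_def by (rule Least_le)
qed

lemma colon_vars_eq_UNIV_iff:
  fixes J :: "('n::finite, 'k::field) mvpoly set"
  assumes J: "ideal J polyring"
  shows "colon_vars J t = UNIV \<longleftrightarrow> ideal_power polyring vars_ideal t \<subseteq> J"
proof
  assume "colon_vars J t = UNIV"
  \<comment> \<open>The element 1 in the colon ideal says precisely that the power itself lies in
    \<open>J\<close>.\<close>
  then have "1 \<in> colon_vars J t" by simp
  then show "ideal_power polyring vars_ideal t \<subseteq> J" by (auto simp: mem_colon_vars_iff)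
next
  assume "ideal_power polyring vars_ideal t \<subseteq> J"
  then show "colon_vars J t = UNIV"
    unfolding set_eq_iff mem_colon_vars_iff using polyring_ideal_mult[OF J] by blast
qed

lemma sat_le_iff_vars_power_subset:
  fixes J :: "('n::finite, 'k::field) mvpoly set"
  assumes J: "ideal J polyring" and sub: "ideal_power polyring vars_ideal s\<^sub>0 \<subseteq> J"
  shows "sat J \<le> s \<longleftrightarrow> ideal_power polyring vars_ideal s \<subseteq> J"
proof -
  note UNIV_iff = colon_vars_eq_UNIV_iff[OF J]
  have top: "colon_vars J t = UNIV" if "s\<^sub>0 \<le> t" for t
    using vars_power_antimono[OF that] sub unfolding UNIV_iff by blast
  have "sat J \<le> s \<longleftrightarrow> colon_vars J s = colon_vars J (s + 1)"
    by (rule sat_le_iff[OF J, of s\<^sub>0]) (simp only: top le_add1 order_refl)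
  also have "\<dots> \<longleftrightarrow> colon_vars J s = UNIV"
  proof
    assume "colon_vars J s = colon_vars J (s + 1)"
    \<comment> \<open>A chain that repeats at \<open>s\<close> is constant from there on, yet it
      equals the whole ring from \<open>s\<^sub>0\<close> on; the index
      \<open>max s s\<^sub>0\<close> lies in both ranges.\<close>
    then have "colon_vars J (max s s\<^sub>0) = colon_vars J s"
      by (rule colon_vars_stable[OF J]) simp
    then show "colon_vars J s = UNIV" using top[of "max s s\<^sub>0"] by simp
  next
    assume s: "colon_vars J s = UNIV"
    then have "colon_vars J (s + 1) = UNIV"
      unfolding UNIV_iff using vars_power_antimono[of s "s + 1"] by auto
    with s show "colon_vars J s = colon_vars J (s + 1)" by simp
  qed
  finally show ?thesis unfolding UNIV_iff .
qed

text \<open>This supplies the repetition required by \<open>sat_le_iff\<close> without using the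
  ascending chain condition: the chain reaches the whole ring if \<open>A = UNIV\<close> and is
  constant from the start otherwise.\<close>

lemma colon_vars_irred_power_stabilises:
  assumes c: "\<And>i. i \<in> A \<Longrightarrow> c i > 0"
  shows "\<exists>s. colon_vars (ideal_power polyring (irred A c) k) s
    = colon_vars (ideal_power polyring (irred A c) k) (s + 1)"
    (is "\<exists>s. colon_vars ?J s = _")
proof (cases "A = UNIV")
  case True
  obtain s where s: "ideal_power polyring vars_ideal s \<subseteq> ?J"
    using vars_power_subset_irred_power[of c k] c unfolding True by auto
  have "colon_vars ?J t = UNIV" if "s \<le> t" for t
    unfolding colon_vars_eq_UNIV_iff[OF ideal_ideal_power[OF ideal_irred]]
    by (rule subset_trans[OF vars_power_antimono[OF that] s])
  then have "colon_vars ?J s = colon_vars ?J (s + 1)" by (simp only: order_refl le_add1)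
  then show ?thesis ..
next
  case False
  obtain j where j: "j \<notin> A" using False by blast
  have mem: "f \<in> ?J \<longleftrightarrow> (\<forall>a\<in>keys f. k \<le> weight A c a)" for f
    by (rule mem_irred_power_iff) (rule c)
  have "colon_vars ?J s = ?J" for s
  proof
    show "colon_vars ?J s \<subseteq> ?J"
    proof
      fix f assume f: "f \<in> colon_vars ?J s"
      \<comment> \<open>The power of degree \<open>s\<close> of the missing variable lies in the
        \<open>s\<close>-th power of the maximal ideal and leaves all weights unchanged.\<close>
      let ?b = "Poly_Mapping.single j s"
      have deg: "(\<Sum>i\<in>UNIV. lookup ?b i) = s" by (simp add: lookup_single when_def)
      have "f * monomial ?b \<in> ?J"
        by (rule bspec[OF f[unfolded mem_colon_vars_iff]]) (simp add: mem_vars_power_iff deg)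
      then have "\<forall>a\<in>keys f. k \<le> weight A c (a + ?b)"
        unfolding mem keys_mult_monomial by blast
      moreover have "weight A c (a + ?b) = weight A c a" for a
        unfolding weight_def using j by (intro sum.cong) (auto simp: lookup_add lookup_single when_def)
      ultimately show "f \<in> ?J" unfolding mem by simp
    qed
    show "?J \<subseteq> colon_vars ?J s"
      using polyring_ideal_mult[OF ideal_ideal_power[OF ideal_irred]]
      by (auto simp: mem_colon_vars_iff mult.commute)
  qed
  then show ?thesis by blast
qed

text \<open>Some power of each variable lies in \<open>I\<close>, hence in \<open>irred A c\<close>;
  the only generator that can divide it is a power of the same variable.\<close>

lemma vars_primary_component:
  fixes I :: "('n::finite, 'k::field) mvpoly set"
  assumes "vars_primary I" and "I \<subseteq> irred A c" and c: "\<And>i. i \<in> A \<Longrightarrow> c i > 0"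
  shows "A = UNIV"
proof -
  have "j \<in> A" for j
  proof -
    have "variable j \<in> (vars_ideal :: ('n, 'k) mvpoly set)"
      using irred_generator[of j UNIV "\<lambda>_. 1"] by (simp add: vars_ideal_eq variable_def)
    then obtain e where e: "variable j [^]\<^bsub>polyring\<^esub> (e::nat) \<in> I"
      using assms(1) unfolding vars_primary_def radical_ideal_def by blast
    have "variable j [^]\<^bsub>polyring\<^esub> e = (variable j ^ e :: ('n, 'k) mvpoly)" for e :: nat
      by (induction e) (simp_all add: mult.commute)
    then have "(variable j ^ e :: ('n, 'k) mvpoly) \<in> irred A c" using e assms(2) by auto
    then obtain i where "i \<in> A" "c i \<le> lookup (Poly_Mapping.single j e) i"
      unfolding mem_irred_iff by (auto simp: variable_power)
    then show "j \<in> A" using c[of i] by (auto simp: lookup_single when_def split: if_splits)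
  qed
  then show ?thesis by blast
qed

section \<open>Comparison of ordinary and symbolic powers, and their saturation numbers\<close>

theorem proposition2p5:
  fixes I :: "('n::finite, 'k::field) mvpoly set"
    and q :: "nat \<Rightarrow> ('n, 'k) mvpoly set"
    and r k :: nat
  assumes "monomial_ideal I"
    and "irredundant_decomposition I r q"
    and "k \<ge> 1"
  shows "ideal_power polyring I k \<subseteq> symbolic_power I k
    \<and> sat (symbolic_power I k) \<le> Max ((\<lambda>i. sat (ideal_power polyring (q i) k)) ` {1..r})
    \<and> (vars_primary I \<longrightarrow>
        sat (symbolic_power I k) = Max ((\<lambda>i. sat (ideal_power polyring (q i) k)) ` {1..r}))"
proof (intro conjI impI)
  let ?p = "\<lambda>i. ideal_power polyring (q i) k"
  define s where "s = Max ((\<lambda>i. sat (?p i)) ` {1..r})"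
  have r: "r \<ge> 1" and I: "I = (\<Inter>i\<in>{1..r}. q i)"
    using assms(2) unfolding irredundant_decomposition_def by blast+
  have symb: "symbolic_power I k = (\<Inter>i\<in>{1..r}. ?p i)"
    unfolding symbolic_power_def irreducible_components_eq[OF assms(2)] by simp
  have "\<forall>i\<in>{1..r}. \<exists>A c. (\<forall>l\<in>A. c l > 0) \<and> q i = irred A c"
    using assms(2) unfolding irredundant_decomposition_def irreducible_monomial_ideal_def by blast
  then obtain A c where c: "\<And>i l. i \<in> {1..r} \<Longrightarrow> l \<in> A i \<Longrightarrow> c i l > 0"
    and q: "\<And>i. i \<in> {1..r} \<Longrightarrow> q i = irred (A i) (c i)"
    by metis
  have ideal: "ideal (?p i) polyring" if "i \<in> {1..r}" for i
    unfolding q[OF that] by (rule ideal_ideal_power[OF ideal_irred])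
  have sat_le: "sat (?p i) \<le> s" if "i \<in> {1..r}" for i
    unfolding s_def using that by (intro Max_ge) auto

  \<comment> \<open>Part (a): \<open>I\<close> lies in every component, and taking powers preserves
    inclusion.\<close>
  show "ideal_power polyring I k \<subseteq> symbolic_power I k"
    unfolding symb using ideal_power_mono[of I] I by blast

  \<comment> \<open>Part (b): \<open>s\<close> is at least every component's saturation number, so
    all component chains repeat at this common index, and so does their intersection.\<close>
  have "colon_vars (?p i) s = colon_vars (?p i) (s + 1)" if i: "i \<in> {1..r}" for i
    using sat_le_iff[OF ideal[OF i]] sat_le[OF i]
      colon_vars_irred_power_stabilises[of "A i" "c i" k, OF c[OF i]]
    unfolding q[OF i] by blast
  moreover have "colon_vars (symbolic_power I k) t = (\<Inter>i\<in>{1..r}. colon_vars (?p i) t)" for t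
    unfolding symb colon_ideal_def by auto
  ultimately have "colon_vars (symbolic_power I k) s = colon_vars (symbolic_power I k) (s + 1)"
    by (simp only: cong: INF_cong)
  then have le: "sat (symbolic_power I k) \<le> s"
    \<comment> \<open>A repetition at \<open>s\<close> alone bounds the least such index.\<close>
    unfolding sat_def by (rule Least_le)
  then show "sat (symbolic_power I k) \<le> Max ((\<lambda>i. sat (?p i)) ` {1..r})"
    unfolding s_def .

  assume primary: "vars_primary I"
  \<comment> \<open>Part (c): every component now involves all variables, so its saturation number
    is detected by containment of powers of the maximal ideal.\<close>
  have le_iff: "sat (?p i) \<le> t \<longleftrightarrow> ideal_power polyring vars_ideal t \<subseteq> ?p i"
    if i: "i \<in> {1..r}" for i t
  proof -
    have "I \<subseteq> irred (A i) (c i)" using I i q by blast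
    then have "A i = UNIV" using vars_primary_component[OF primary] c[OF i] by blast
    then obtain s\<^sub>0 where "ideal_power polyring vars_ideal s\<^sub>0 \<subseteq> ?p i"
      using vars_power_subset_irred_power[of "c i" k] c[OF i] q[OF i] by auto
    then show ?thesis by (rule sat_le_iff_vars_power_subset[OF ideal[OF i]])
  qed
  have symb_ideal: "ideal (symbolic_power I k) polyring"
    unfolding symb
    by (rule ideal_polyringI)
      (blast intro: polyring_ideal_zero polyring_ideal_add polyring_ideal_mult ideal)+
  have "ideal_power polyring vars_ideal s \<subseteq> symbolic_power I k"
    unfolding symb using le_iff sat_le by blast
  \<comment> \<open>The inclusion at \<open>s\<close> makes the containment criterion available for
    the symbolic power; it is applied with its own saturation number as the bound.\<close>
  then have "ideal_power polyring vars_ideal (sat (symbolic_power I k)) \<subseteq> symbolic_power I k"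
    using sat_le_iff_vars_power_subset[OF symb_ideal] by blast
  then have "sat (?p i) \<le> sat (symbolic_power I k)" if "i \<in> {1..r}" for i
    using le_iff[OF that] that unfolding symb by blast
  then have "s \<le> sat (symbolic_power I k)"
    unfolding s_def using r by (subst Max_le_iff) auto
  with le show "sat (symbolic_power I k) = Max ((\<lambda>i. sat (?p i)) ` {1..r})"
    unfolding s_def by simp
qed

end
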